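(* The category $\ell\mathbb{G}rp$ of lattice-ordered groups satisfies the condition (NH) of normality of Higgins commutators.
   Context: A lattice-ordered group is an algebra $(X,\cdot,e,(-)^{-1},\lor)$ such that $(X,\cdot,e,(-)^{-1})$ is a group, $(X,\lor)$ is a semilattice ($\lor$ is associative, commutative, idempotent), and $x(y\lor z)=xy\lor xz$, $(x\lor y)z=xz\lor yz$ for all $x,y,z$. Morphisms are the maps preserving the group product and $\lor$; this defines the category $\ell\mathbb{G}rp$, which is semi-abelian (pointed, Barr-exact, with finite coproducts, protomodular). In a semi-abelian category $\mathbb{C}$, for objects $A,B$ let $\Sigma\colon A+B\to A\times B$ be the canonical arrow whose composites with the coproduct injections of $A$ and $B$ are $(id_A,0)$ and $(0,id_B)$ respectively, and let $k_{A,B}\colon A\diamond B\to A+B$ be the kernel of $\Sigma$. Given subobjects $a\colon A\rightarrowtail X$ and $b\colon B\rightarrowtail X$, the Higgins commutator $[A,B]\rightarrowtail X$ is the regular image (the monomorphism part of the (regular epimorphism, monomorphism)-factorization) of the composite $[a,b]\circ k_{A,B}\colon A\diamond B\to A+B\to X$. A normal subobject is one that is the kernel of some morphism. A semi-abelian category satisfies (NH) when, for every object $X$ and every pair of normal subobjects $H\rightarrowtail X$, $K\rightarrowtail X$, the Higgins commutator $[H,K]\rightarrowtail X$ is a normal subobject of $X$. *)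

theory Defs
  imports "HOL-Algebra.Coset"
begin

section \<open>Lattice-ordered groups\<close>

record 'a lgrp = "'a monoid" +
  lg_join :: "'a \<Rightarrow> 'a \<Rightarrow> 'a"  (infixl "\<curlyvee>\<index>" 65)

locale lattice_ordered_group = group G for G :: "'a lgrp" (structure) +
  assumes join_closed: "\<lbrakk>x \<in> carrier G; y \<in> carrier G\<rbrakk> \<Longrightarrow> x \<curlyvee> y \<in> carrier G"
    and join_assoc: "\<lbrakk>x \<in> carrier G; y \<in> carrier G; z \<in> carrier G\<rbrakk>
           \<Longrightarrow> (x \<curlyvee> y) \<curlyvee> z = x \<curlyvee> (y \<curlyvee> z)"
    and join_comm: "\<lbrakk>x \<in> carrier G; y \<in> carrier G\<rbrakk> \<Longrightarrow> x \<curlyvee> y = y \<curlyvee> x"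
    and join_idem: "x \<in> carrier G \<Longrightarrow> x \<curlyvee> x = x"
    and mult_join: "\<lbrakk>x \<in> carrier G; y \<in> carrier G; z \<in> carrier G\<rbrakk>
           \<Longrightarrow> x \<otimes> (y \<curlyvee> z) = (x \<otimes> y) \<curlyvee> (x \<otimes> z)"
    and join_mult: "\<lbrakk>x \<in> carrier G; y \<in> carrier G; z \<in> carrier G\<rbrakk>
           \<Longrightarrow> (x \<curlyvee> y) \<otimes> z = (x \<otimes> z) \<curlyvee> (y \<otimes> z)"

definition lhom :: "'a lgrp \<Rightarrow> 'b lgrp \<Rightarrow> ('a \<Rightarrow> 'b) set" where
  "lhom G H = {f \<in> hom G H. \<forall>x\<in>carrier G. \<forall>y\<in>carrier G. f (x \<curlyvee>\<^bsub>G\<^esub> y) = f x \<curlyvee>\<^bsub>H\<^esub> f y}"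

definition lprod :: "'a lgrp \<Rightarrow> 'b lgrp \<Rightarrow> ('a \<times> 'b) lgrp" where
  "lprod A B = \<lparr>carrier = carrier A \<times> carrier B,
     monoid.mult = (\<lambda>(a, b) (a', b'). (a \<otimes>\<^bsub>A\<^esub> a', b \<otimes>\<^bsub>B\<^esub> b')),
     one = (\<one>\<^bsub>A\<^esub>, \<one>\<^bsub>B\<^esub>),
     lg_join = (\<lambda>(a, b) (a', b'). (a \<curlyvee>\<^bsub>A\<^esub> a', b \<curlyvee>\<^bsub>B\<^esub> b'))\<rparr>"

definition sub_lgrp :: "'a lgrp \<Rightarrow> 'a set \<Rightarrow> 'a lgrp" where
  "sub_lgrp G S = G\<lparr>carrier := S\<rparr>"

section \<open>Kernels and normal subobjects\<close>

text \<open>\<open>is_kernel N X Y n f\<close>: the arrow \<open>n : N \<rightarrow> X\<close> is a kernel of \<open>f : X \<rightarrow> Y\<close>. The lemmas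
  \<open>is_kernel_universal\<close> and \<open>is_kernel_if_universal\<close> below relate this to the universal property.\<close>

definition is_kernel ::
  "'n lgrp \<Rightarrow> 'x lgrp \<Rightarrow> 'y lgrp \<Rightarrow> ('n \<Rightarrow> 'x) \<Rightarrow> ('x \<Rightarrow> 'y) \<Rightarrow> bool" where
  "is_kernel N X Y n f \<longleftrightarrow> n \<in> lhom N X \<and> f \<in> lhom X Y \<and>
     inj_on n (carrier N) \<and> n ` carrier N = kernel X Y f"

text \<open>HOL cannot quantify over the type of \<open>Y\<close> inside a definition. Cosets of a
  normal subgroup of \<open>X\<close> have type \<open>'x set\<close>, so this type is large enough:
  lemma \<open>normal_subobjectI\<close> shows that kernels of morphisms into lattice-ordered groups over
  arbitrary types are covered.\<close>

definition normal_subobject :: "'n lgrp \<Rightarrow> 'x lgrp \<Rightarrow> ('n \<Rightarrow> 'x) \<Rightarrow> bool" where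
  "normal_subobject N X n \<longleftrightarrow> (\<exists>(Y :: 'x set lgrp) f.
     lattice_ordered_group Y \<and> is_kernel N X Y n f)"

section \<open>Binary coproducts\<close>

text \<open>The coproduct is presented by generators and relations: terms over the disjoint union of
  the carriers, modulo the least congruence that enforces the axioms of lattice-ordered groups and
  makes the two injections morphisms. The universal property (with respect to
  lattice-ordered groups over arbitrary types) is verified below.\<close>

datatype ('a, 'b) lterm =
    GenL 'a | GenR 'b | Unit | Inv "('a, 'b) lterm"
  | Mul "('a, 'b) lterm" "('a, 'b) lterm" | Join "('a, 'b) lterm" "('a, 'b) lterm"

inductive_set lterms :: "'a lgrp \<Rightarrow> 'b lgrp \<Rightarrow> ('a, 'b) lterm set"
  for A :: "'a lgrp" and B :: "'b lgrp" where
  "a \<in> carrier A \<Longrightarrow> GenL a \<in> lterms A B"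
| "b \<in> carrier B \<Longrightarrow> GenR b \<in> lterms A B"
| "Unit \<in> lterms A B"
| "s \<in> lterms A B \<Longrightarrow> Inv s \<in> lterms A B"
| "\<lbrakk>s \<in> lterms A B; t \<in> lterms A B\<rbrakk> \<Longrightarrow> Mul s t \<in> lterms A B"
| "\<lbrakk>s \<in> lterms A B; t \<in> lterms A B\<rbrakk> \<Longrightarrow> Join s t \<in> lterms A B"

inductive_set lcong :: "'a lgrp \<Rightarrow> 'b lgrp \<Rightarrow> (('a, 'b) lterm \<times> ('a, 'b) lterm) set"
  for A :: "'a lgrp" and B :: "'b lgrp" where
  refl: "s \<in> lterms A B \<Longrightarrow> (s, s) \<in> lcong A B"
| sym: "(s, t) \<in> lcong A B \<Longrightarrow> (t, s) \<in> lcong A B"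
| trans: "\<lbrakk>(s, t) \<in> lcong A B; (t, u) \<in> lcong A B\<rbrakk> \<Longrightarrow> (s, u) \<in> lcong A B"
| Inv: "(s, t) \<in> lcong A B \<Longrightarrow> (Inv s, Inv t) \<in> lcong A B"
| Mul: "\<lbrakk>(s, s') \<in> lcong A B; (t, t') \<in> lcong A B\<rbrakk> \<Longrightarrow> (Mul s t, Mul s' t') \<in> lcong A B"
| Join: "\<lbrakk>(s, s') \<in> lcong A B; (t, t') \<in> lcong A B\<rbrakk> \<Longrightarrow> (Join s t, Join s' t') \<in> lcong A B"
| mul_assoc: "\<lbrakk>s \<in> lterms A B; t \<in> lterms A B; u \<in> lterms A B\<rbrakk>
    \<Longrightarrow> (Mul (Mul s t) u, Mul s (Mul t u)) \<in> lcong A B"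
| unit: "s \<in> lterms A B \<Longrightarrow> (Mul Unit s, s) \<in> lcong A B"
| inv: "s \<in> lterms A B \<Longrightarrow> (Mul (Inv s) s, Unit) \<in> lcong A B"
| join_assoc: "\<lbrakk>s \<in> lterms A B; t \<in> lterms A B; u \<in> lterms A B\<rbrakk>
    \<Longrightarrow> (Join (Join s t) u, Join s (Join t u)) \<in> lcong A B"
| join_comm: "\<lbrakk>s \<in> lterms A B; t \<in> lterms A B\<rbrakk> \<Longrightarrow> (Join s t, Join t s) \<in> lcong A B"
| join_idem: "s \<in> lterms A B \<Longrightarrow> (Join s s, s) \<in> lcong A B"
| mul_join: "\<lbrakk>s \<in> lterms A B; t \<in> lterms A B; u \<in> lterms A B\<rbrakk>
    \<Longrightarrow> (Mul s (Join t u), Join (Mul s t) (Mul s u)) \<in> lcong A B"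
| join_mul: "\<lbrakk>s \<in> lterms A B; t \<in> lterms A B; u \<in> lterms A B\<rbrakk>
    \<Longrightarrow> (Mul (Join s t) u, Join (Mul s u) (Mul t u)) \<in> lcong A B"
| genL_mul: "\<lbrakk>a \<in> carrier A; a' \<in> carrier A\<rbrakk>
    \<Longrightarrow> (GenL (a \<otimes>\<^bsub>A\<^esub> a'), Mul (GenL a) (GenL a')) \<in> lcong A B"
| genL_join: "\<lbrakk>a \<in> carrier A; a' \<in> carrier A\<rbrakk>
    \<Longrightarrow> (GenL (a \<curlyvee>\<^bsub>A\<^esub> a'), Join (GenL a) (GenL a')) \<in> lcong A B"
| genR_mul: "\<lbrakk>b \<in> carrier B; b' \<in> carrier B\<rbrakk>
    \<Longrightarrow> (GenR (b \<otimes>\<^bsub>B\<^esub> b'), Mul (GenR b) (GenR b')) \<in> lcong A B"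
| genR_join: "\<lbrakk>b \<in> carrier B; b' \<in> carrier B\<rbrakk>
    \<Longrightarrow> (GenR (b \<curlyvee>\<^bsub>B\<^esub> b'), Join (GenR b) (GenR b')) \<in> lcong A B"

definition lclass :: "'a lgrp \<Rightarrow> 'b lgrp \<Rightarrow> ('a, 'b) lterm \<Rightarrow> ('a, 'b) lterm set" where
  "lclass A B s = lcong A B `` {s}"

definition coprod :: "'a lgrp \<Rightarrow> 'b lgrp \<Rightarrow> ('a, 'b) lterm set lgrp" where
  "coprod A B = \<lparr>carrier = lterms A B // lcong A B,
     monoid.mult = (\<lambda>P Q. \<Union>s\<in>P. \<Union>t\<in>Q. lclass A B (Mul s t)),
     one = lclass A B Unit,
     lg_join = (\<lambda>P Q. \<Union>s\<in>P. \<Union>t\<in>Q. lclass A B (Join s t))\<rparr>"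

definition inj_left :: "'a lgrp \<Rightarrow> 'b lgrp \<Rightarrow> 'a \<Rightarrow> ('a, 'b) lterm set" where
  "inj_left A B a = lclass A B (GenL a)"

definition inj_right :: "'a lgrp \<Rightarrow> 'b lgrp \<Rightarrow> 'b \<Rightarrow> ('a, 'b) lterm set" where
  "inj_right A B b = lclass A B (GenR b)"

primrec lterm_eval :: "'c lgrp \<Rightarrow> ('a \<Rightarrow> 'c) \<Rightarrow> ('b \<Rightarrow> 'c) \<Rightarrow> ('a, 'b) lterm \<Rightarrow> 'c" where
  "lterm_eval C f g (GenL a) = f a"
| "lterm_eval C f g (GenR b) = g b"
| "lterm_eval C f g Unit = \<one>\<^bsub>C\<^esub>"
| "lterm_eval C f g (Inv s) = inv\<^bsub>C\<^esub> (lterm_eval C f g s)"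
| "lterm_eval C f g (Mul s t) = lterm_eval C f g s \<otimes>\<^bsub>C\<^esub> lterm_eval C f g t"
| "lterm_eval C f g (Join s t) = lterm_eval C f g s \<curlyvee>\<^bsub>C\<^esub> lterm_eval C f g t"

text \<open>The copairing \<open>[f, g] : A + B \<rightarrow> C\<close>; evaluation is constant on each congruence class.\<close>

definition copair :: "'c lgrp \<Rightarrow> ('a \<Rightarrow> 'c) \<Rightarrow> ('b \<Rightarrow> 'c) \<Rightarrow> ('a, 'b) lterm set \<Rightarrow> 'c" where
  "copair C f g P = the_elem (lterm_eval C f g ` P)"

section \<open>The Higgins commutator\<close>

definition Sigma_map :: "'a lgrp \<Rightarrow> 'b lgrp \<Rightarrow> ('a, 'b) lterm set \<Rightarrow> 'a \<times> 'b" where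
  "Sigma_map A B = copair (lprod A B) (\<lambda>a. (a, \<one>\<^bsub>B\<^esub>)) (\<lambda>b. (\<one>\<^bsub>A\<^esub>, b))"

text \<open>The object \<open>A \<diamond> B\<close>, whose arrow into \<open>A + B\<close> is the inclusion.\<close>

definition diamond :: "'a lgrp \<Rightarrow> 'b lgrp \<Rightarrow> ('a, 'b) lterm set lgrp" where
  "diamond A B = sub_lgrp (coprod A B) (kernel (coprod A B) (lprod A B) (Sigma_map A B))"

text \<open>The regular image of \<open>A \<diamond> B \<rightarrow> A + B \<rightarrow> X\<close>, whose arrow into \<open>X\<close> is the inclusion.\<close>

definition higgins_commutator ::
  "'a lgrp \<Rightarrow> 'b lgrp \<Rightarrow> 'x lgrp \<Rightarrow> ('a \<Rightarrow> 'x) \<Rightarrow> ('b \<Rightarrow> 'x) \<Rightarrow> 'x lgrp" where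
  "higgins_commutator A B X a b = sub_lgrp X (copair X a b ` carrier (diamond A B))"

section \<open>Universal properties\<close>

lemma lhomD:
  assumes "f \<in> lhom G H"
  shows "f \<in> hom G H" "x \<in> carrier G \<Longrightarrow> f x \<in> carrier H"
    "\<lbrakk>x \<in> carrier G; y \<in> carrier G\<rbrakk> \<Longrightarrow> f (x \<otimes>\<^bsub>G\<^esub> y) = f x \<otimes>\<^bsub>H\<^esub> f y"
    "\<lbrakk>x \<in> carrier G; y \<in> carrier G\<rbrakk> \<Longrightarrow> f (x \<curlyvee>\<^bsub>G\<^esub> y) = f x \<curlyvee>\<^bsub>H\<^esub> f y"
  using assms by (auto simp: lhom_def hom_def)

lemma lhomI:
  assumes "\<And>x. x \<in> carrier G \<Longrightarrow> f x \<in> carrier H"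
    "\<And>x y. \<lbrakk>x \<in> carrier G; y \<in> carrier G\<rbrakk> \<Longrightarrow> f (x \<otimes>\<^bsub>G\<^esub> y) = f x \<otimes>\<^bsub>H\<^esub> f y"
    "\<And>x y. \<lbrakk>x \<in> carrier G; y \<in> carrier G\<rbrakk> \<Longrightarrow> f (x \<curlyvee>\<^bsub>G\<^esub> y) = f x \<curlyvee>\<^bsub>H\<^esub> f y"
  shows "f \<in> lhom G H"
  using assms by (auto simp: lhom_def hom_def)

lemma lhom_group:
  assumes "lattice_ordered_group G" "lattice_ordered_group H" "f \<in> lhom G H"
  shows "group_hom G H f" "f \<one>\<^bsub>G\<^esub> = \<one>\<^bsub>H\<^esub>"
    "x \<in> carrier G \<Longrightarrow> f (inv\<^bsub>G\<^esub> x) = inv\<^bsub>H\<^esub> f x"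
proof -
  show gh: "group_hom G H f"
    using assms by (auto simp: group_hom_def group_hom_axioms_def lattice_ordered_group_def lhom_def)
  show "f \<one>\<^bsub>G\<^esub> = \<one>\<^bsub>H\<^esub>" "x \<in> carrier G \<Longrightarrow> f (inv\<^bsub>G\<^esub> x) = inv\<^bsub>H\<^esub> f x"
    using gh by (auto simp: group_hom.hom_one group_hom.hom_inv)
qed

lemma lgrp_groupD: "lattice_ordered_group G \<Longrightarrow> group G"
  by (simp add: lattice_ordered_group_def)

lemma sub_lgrp_simps [simp]:
  "carrier (sub_lgrp G S) = S" "monoid.mult (sub_lgrp G S) = monoid.mult G"
  "one (sub_lgrp G S) = one G" "lg_join (sub_lgrp G S) = lg_join G"
  by (simp_all add: sub_lgrp_def)

lemma sub_lgrp_lgroup: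
  assumes G: "lattice_ordered_group G" and S: "subgroup S G"
    and J: "\<And>x y. \<lbrakk>x \<in> S; y \<in> S\<rbrakk> \<Longrightarrow> x \<curlyvee>\<^bsub>G\<^esub> y \<in> S"
  shows "lattice_ordered_group (sub_lgrp G S)"
proof -
  interpret G: lattice_ordered_group G by fact
  have sub: "x \<in> carrier G" if "x \<in> S" for x using that S by (rule subgroup.mem_carrier[rotated])
  have "group (sub_lgrp G S)"
    using subgroup.subgroup_is_group[OF S G.is_group] by (simp add: sub_lgrp_def)
  then show ?thesis
    by (intro lattice_ordered_group.intro lattice_ordered_group_axioms.intro)
      (auto simp: J sub G.join_assoc G.join_idem G.mult_join G.join_mult intro: G.join_comm)
qed

lemma image_lgroup:
  assumes G: "lattice_ordered_group G" and H: "lattice_ordered_group H" and f: "f \<in> lhom G H"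
  shows "lattice_ordered_group (sub_lgrp H (f ` carrier G))" "f \<in> lhom G (sub_lgrp H (f ` carrier G))"
proof -
  interpret G: lattice_ordered_group G by fact
  interpret f: group_hom G H f using lhom_group[OF G H f] by simp
  show "lattice_ordered_group (sub_lgrp H (f ` carrier G))"
  proof (rule sub_lgrp_lgroup[OF H f.img_is_subgroup])
    fix x y assume "x \<in> f ` carrier G" "y \<in> f ` carrier G"
    then show "x \<curlyvee>\<^bsub>H\<^esub> y \<in> f ` carrier G"
      by (auto simp: lhomD(4)[OF f, symmetric] intro: G.join_closed)
  qed
  show "f \<in> lhom G (sub_lgrp H (f ` carrier G))"
    using lhomD[OF f] by (intro lhomI) auto
qed

text \<open>Surjective morphisms are regular epimorphisms (the coequalizer of their kernel pair), so
  that the set-theoretic image is the regular image.\<close>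

lemma surj_coequalizer:
  assumes G: "lattice_ordered_group G"
    and q: "q \<in> lhom G Q" "q ` carrier G = carrier Q"
    and f: "f \<in> lhom G C"
    and eq: "\<And>x y. \<lbrakk>x \<in> carrier G; y \<in> carrier G; q x = q y\<rbrakk> \<Longrightarrow> f x = f y"
  shows "\<exists>u \<in> lhom Q C. \<forall>x\<in>carrier G. u (q x) = f x"
proof -
  interpret G: lattice_ordered_group G by fact
  define u where "u = (\<lambda>z. f (inv_into (carrier G) q z))"
  have u: "u (q x) = f x" if "x \<in> carrier G" for x
    unfolding u_def using that by (intro eq inv_into_into f_inv_into_f) auto
  have "u \<in> lhom Q C"
  proof (rule lhomI)
    fix z assume "z \<in> carrier Q"
    then obtain x where "x \<in> carrier G" "z = q x" using q(2) by blast
    then show "u z \<in> carrier C" using u lhomD[OF f] by simp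
  next
    fix z w assume "z \<in> carrier Q" "w \<in> carrier Q"
    then obtain x y where xy: "x \<in> carrier G" "z = q x" "y \<in> carrier G" "w = q y"
      using q(2) by blast
    show "u (z \<otimes>\<^bsub>Q\<^esub> w) = u z \<otimes>\<^bsub>C\<^esub> u w"
      using xy by (simp add: u lhomD[OF f] lhomD(3)[OF q(1), symmetric])
    show "u (z \<curlyvee>\<^bsub>Q\<^esub> w) = u z \<curlyvee>\<^bsub>C\<^esub> u w"
      using xy by (simp add: u lhomD[OF f] lhomD(4)[OF q(1), symmetric] G.join_closed)
  qed
  with u show ?thesis by blast
qed

lemma lprod_lgroup:
  assumes A: "lattice_ordered_group A" and B: "lattice_ordered_group B"
  shows "lattice_ordered_group (lprod A B)"
proof -
  interpret A: lattice_ordered_group A by fact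
  interpret B: lattice_ordered_group B by fact
  have "group (lprod A B)"
  proof (rule groupI)
    fix x assume "x \<in> carrier (lprod A B)"
    then show "\<exists>y\<in>carrier (lprod A B). y \<otimes>\<^bsub>lprod A B\<^esub> x = \<one>\<^bsub>lprod A B\<^esub>"
      by (intro bexI[of _ "(inv\<^bsub>A\<^esub> fst x, inv\<^bsub>B\<^esub> snd x)"]) (auto simp: lprod_def)
  qed (auto simp: lprod_def A.m_assoc B.m_assoc)
  then show ?thesis
    by (intro lattice_ordered_group.intro lattice_ordered_group_axioms.intro)
      (auto simp: lprod_def A.join_closed B.join_closed A.join_assoc B.join_assoc
         A.join_idem B.join_idem A.mult_join B.mult_join A.join_mult B.join_mult
         intro: A.join_comm B.join_comm)
qed

lemma lprod_universal:
  shows "fst \<in> lhom (lprod A B) A" "snd \<in> lhom (lprod A B) B"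
    and "\<lbrakk>f \<in> lhom C A; g \<in> lhom C B\<rbrakk> \<Longrightarrow> (\<lambda>c. (f c, g c)) \<in> lhom C (lprod A B)"
  by (auto simp: lprod_def lhom_def hom_def)

lemma kernel_lgroup:
  assumes X: "lattice_ordered_group X" and Y: "lattice_ordered_group Y" and f: "f \<in> lhom X Y"
  shows "lattice_ordered_group (sub_lgrp X (kernel X Y f))"
    "is_kernel (sub_lgrp X (kernel X Y f)) X Y (\<lambda>x. x) f"
proof -
  interpret X: lattice_ordered_group X by fact
  interpret Y: lattice_ordered_group Y by fact
  interpret f: group_hom X Y f using lhom_group[OF X Y f] by simp
  show "lattice_ordered_group (sub_lgrp X (kernel X Y f))"
    by (rule sub_lgrp_lgroup[OF X f.subgroup_kernel])
      (auto simp: kernel_def X.join_closed lhomD[OF f] Y.join_idem)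
  show "is_kernel (sub_lgrp X (kernel X Y f)) X Y (\<lambda>x. x) f"
    using f by (auto simp: is_kernel_def kernel_def intro!: lhomI)
qed

lemma is_kernel_universal:
  assumes N: "lattice_ordered_group N" and k: "is_kernel N X Y n f"
  shows "\<forall>x\<in>carrier N. f (n x) = \<one>\<^bsub>Y\<^esub>"
    and "\<lbrakk>lattice_ordered_group Z; g \<in> lhom Z X; \<forall>z\<in>carrier Z. f (g z) = \<one>\<^bsub>Y\<^esub>\<rbrakk>
      \<Longrightarrow> \<exists>u \<in> lhom Z N. (\<forall>z\<in>carrier Z. n (u z) = g z) \<and>
            (\<forall>v \<in> lhom Z N. (\<forall>z\<in>carrier Z. n (v z) = g z) \<longrightarrow> (\<forall>z\<in>carrier Z. v z = u z))"
proof -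
  interpret N: lattice_ordered_group N by fact
  have n: "n \<in> lhom N X" and inj: "inj_on n (carrier N)" and im: "n ` carrier N = kernel X Y f"
    using k by (auto simp: is_kernel_def)
  show "\<forall>x\<in>carrier N. f (n x) = \<one>\<^bsub>Y\<^esub>"
    using im by (auto simp: kernel_def)
  assume Z: "lattice_ordered_group Z" and g: "g \<in> lhom Z X" and z: "\<forall>z\<in>carrier Z. f (g z) = \<one>\<^bsub>Y\<^esub>"
  interpret Z: lattice_ordered_group Z by fact
  define u where "u = (\<lambda>z. inv_into (carrier N) n (g z))"
  have gz: "g z \<in> n ` carrier N" if "z \<in> carrier Z" for z
    unfolding im using that z lhomD[OF g] by (auto simp: kernel_def)
  have uc: "u z \<in> carrier N" and nu: "n (u z) = g z" if "z \<in> carrier Z" for z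
    unfolding u_def using gz[OF that] by (auto intro: inv_into_into f_inv_into_f)
  have "u \<in> lhom Z N"
    by (rule lhomI; (rule inj_onD[OF inj])?)
      (auto simp: uc nu lhomD[OF n] lhomD[OF g] Z.join_closed N.join_closed)
  moreover have "v z = u z"
    if "v \<in> lhom Z N" "\<forall>z\<in>carrier Z. n (v z) = g z" "z \<in> carrier Z" for v z
    using that by (intro inj_onD[OF inj]) (auto simp: uc nu lhomD(2)[OF that(1)])
  ultimately show "\<exists>u \<in> lhom Z N. (\<forall>z\<in>carrier Z. n (u z) = g z) \<and>
        (\<forall>v \<in> lhom Z N. (\<forall>z\<in>carrier Z. n (v z) = g z) \<longrightarrow> (\<forall>z\<in>carrier Z. v z = u z))"
    using nu by blast
qed

text \<open>Conversely, two test objects suffice: one over \<open>'x\<close> for existence, one over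
  \<open>'n \<times> 'n\<close> (the kernel pair of \<open>n\<close>) for uniqueness.\<close>

lemma is_kernel_if_universal:
  fixes X :: "'x lgrp" and N :: "'n lgrp"
  assumes N: "lattice_ordered_group N" and X: "lattice_ordered_group X"
    and Y: "lattice_ordered_group Y"
    and n: "n \<in> lhom N X" and f: "f \<in> lhom X Y" and null: "\<forall>x\<in>carrier N. f (n x) = \<one>\<^bsub>Y\<^esub>"
    and ex: "\<And>(Z :: 'x lgrp) g. \<lbrakk>lattice_ordered_group Z; g \<in> lhom Z X;
        \<forall>z\<in>carrier Z. f (g z) = \<one>\<^bsub>Y\<^esub>\<rbrakk> \<Longrightarrow> \<exists>u \<in> lhom Z N. \<forall>z\<in>carrier Z. n (u z) = g z"
    and uniq: "\<And>(Z :: ('n \<times> 'n) lgrp) u v. \<lbrakk>lattice_ordered_group Z; u \<in> lhom Z N; v \<in> lhom Z N;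
        \<forall>z\<in>carrier Z. n (u z) = n (v z)\<rbrakk> \<Longrightarrow> \<forall>z\<in>carrier Z. u z = v z"
  shows "is_kernel N X Y n f"
proof -
  interpret N: lattice_ordered_group N by fact
  interpret X: lattice_ordered_group X by fact
  interpret n: group_hom N X n using lhom_group[OF N X n] by simp
  let ?K = "sub_lgrp X (kernel X Y f)"
  have "kernel X Y f \<subseteq> n ` carrier N"
  proof -
    have "(\<lambda>x. x) \<in> lhom ?K X" "\<forall>z\<in>carrier ?K. f z = \<one>\<^bsub>Y\<^esub>"
      using kernel_lgroup(2)[OF X Y f] by (simp_all add: is_kernel_def kernel_def)
    from ex[OF kernel_lgroup(1)[OF X Y f] this]
    obtain u where u: "u \<in> lhom ?K N" "\<forall>z\<in>carrier ?K. n (u z) = z" by blast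
    show ?thesis
    proof
      fix x assume "x \<in> kernel X Y f"
      then have "u x \<in> carrier N" "n (u x) = x" using u(2) lhomD(2)[OF u(1), of x] by simp_all
      then show "x \<in> n ` carrier N" by force
    qed
  qed
  moreover have "n ` carrier N \<subseteq> kernel X Y f"
    using null lhomD[OF n] by (auto simp: kernel_def)
  moreover have "inj_on n (carrier N)"
  proof (rule inj_onI)
    fix x y assume xy: "x \<in> carrier N" "y \<in> carrier N" "n x = n y"
    define R where "R = {p \<in> carrier (lprod N N). n (fst p) = n (snd p)}"
    interpret P: lattice_ordered_group "lprod N N" by (rule lprod_lgroup[OF N N])
    have "subgroup R (lprod N N)"
    proof (rule P.subgroupI)
      have "(x, y) \<in> R" using xy by (simp add: R_def lprod_def)
      then show "R \<noteq> {}" by blast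
      show "R \<subseteq> carrier (lprod N N)" by (simp add: R_def)
    next
      fix p assume p: "p \<in> R"
      have "inv\<^bsub>lprod N N\<^esub> p = (inv\<^bsub>N\<^esub> fst p, inv\<^bsub>N\<^esub> snd p)"
        by (rule P.inv_equality) (use p in \<open>auto simp: R_def lprod_def\<close>)
      then show "inv\<^bsub>lprod N N\<^esub> p \<in> R"
        using p by (auto simp: R_def lprod_def)
    next
      fix p q assume "p \<in> R" "q \<in> R"
      then show "p \<otimes>\<^bsub>lprod N N\<^esub> q \<in> R" by (auto simp: R_def lprod_def)
    qed
    then have R: "lattice_ordered_group (sub_lgrp (lprod N N) R)"
      by (rule sub_lgrp_lgroup[OF P.lattice_ordered_group_axioms])
        (auto simp: R_def lprod_def N.join_closed lhomD[OF n])
    have "\<forall>z\<in>carrier (sub_lgrp (lprod N N) R). fst z = snd z"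
      by (rule uniq[OF R]) (auto simp: R_def lprod_def intro!: lhomI)
    then show "x = y" using xy by (auto simp: R_def lprod_def)
  qed
  ultimately show ?thesis using n f by (auto simp: is_kernel_def)
qed

lemma normal_subobjectI:
  fixes X :: "'x lgrp" and Y :: "'y lgrp"
  assumes X: "lattice_ordered_group X" and Y: "lattice_ordered_group Y" and k: "is_kernel N X Y n f"
  shows "normal_subobject N X n"
proof -
  interpret X: lattice_ordered_group X by fact
  interpret Y: lattice_ordered_group Y by fact
  have f: "f \<in> lhom X Y" using k by (simp add: is_kernel_def)
  define I where "I = sub_lgrp Y (f ` carrier X)"
  interpret I: lattice_ordered_group I unfolding I_def by (rule image_lgroup[OF X Y f])
  have fI: "f \<in> lhom X I" unfolding I_def by (rule image_lgroup[OF X Y f])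
  define r where "r = (\<lambda>y. {x \<in> carrier X. f x = y})"
  define s where "s = (\<lambda>C. f (SOME x. x \<in> C))"
  have sr: "s (r y) = y" if "y \<in> carrier I" for y
  proof -
    have "\<exists>x. x \<in> r y" using that by (auto simp: r_def I_def)
    then have "(SOME x. x \<in> r y) \<in> r y" by (rule someI_ex)
    then show ?thesis by (simp add: s_def r_def)
  qed
  define Q where "Q = \<lparr>carrier = r ` carrier I, monoid.mult = (\<lambda>C D. r (s C \<otimes>\<^bsub>I\<^esub> s D)),
     one = r \<one>\<^bsub>I\<^esub>, lg_join = (\<lambda>C D. r (s C \<curlyvee>\<^bsub>I\<^esub> s D))\<rparr>"
  have "group Q"
  proof (rule groupI)
    fix x assume "x \<in> carrier Q"
    then show "\<exists>y\<in>carrier Q. y \<otimes>\<^bsub>Q\<^esub> x = \<one>\<^bsub>Q\<^esub>"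
      by (intro bexI[of _ "r (inv\<^bsub>I\<^esub> s x)"]) (auto simp: Q_def sr)
  qed (auto simp: Q_def sr I.m_assoc)
  then have Q: "lattice_ordered_group Q"
    by (intro lattice_ordered_group.intro lattice_ordered_group_axioms.intro)
      (auto simp: Q_def sr I.join_closed I.join_assoc I.join_idem I.mult_join I.join_mult
         intro!: arg_cong[of _ _ r] I.join_comm)
  have rf: "(\<lambda>x. r (f x)) \<in> lhom X Q"
    using lhomD[OF fI] by (intro lhomI) (auto simp: Q_def sr)
  have "r (f x) = \<one>\<^bsub>Q\<^esub> \<longleftrightarrow> f x = \<one>\<^bsub>Y\<^esub>" if "x \<in> carrier X" for x
  proof -
    have "r (f x) = r \<one>\<^bsub>I\<^esub> \<longleftrightarrow> f x = \<one>\<^bsub>I\<^esub>"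
      using sr lhomD(2)[OF fI that] I.one_closed by metis
    then show ?thesis by (simp add: Q_def I_def)
  qed
  then have "kernel X Q (\<lambda>x. r (f x)) = kernel X Y f"
    by (auto simp: kernel_def)
  then have "is_kernel N X Q n (\<lambda>x. r (f x))"
    using k rf by (simp add: is_kernel_def)
  with Q show ?thesis unfolding normal_subobject_def by blast
qed

subsection \<open>The universal property of the coproduct\<close>

lemma lcong_lterms:
  assumes A: "lattice_ordered_group A" and B: "lattice_ordered_group B"
  shows "(s, t) \<in> lcong A B \<Longrightarrow> s \<in> lterms A B \<and> t \<in> lterms A B"
proof -
  interpret A: lattice_ordered_group A by fact
  interpret B: lattice_ordered_group B by fact
  show "(s, t) \<in> lcong A B \<Longrightarrow> s \<in> lterms A B \<and> t \<in> lterms A B"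
    by (induction rule: lcong.induct)
      (auto intro: lterms.intros A.join_closed B.join_closed)
qed

lemma lcong_equiv:
  assumes "lattice_ordered_group A" "lattice_ordered_group B"
  shows "equiv (lterms A B) (lcong A B)"
  using lcong_lterms[OF assms]
  by (intro equivI refl_onI symI transI subsetI)
    (auto intro: lcong.refl lcong.sym lcong.trans)

context
  fixes A :: "'a lgrp" and B :: "'b lgrp"
  assumes A: "lattice_ordered_group A" and B: "lattice_ordered_group B"
begin

interpretation A: lattice_ordered_group A by (rule A)
interpretation B: lattice_ordered_group B by (rule B)

abbreviation cls where "cls s \<equiv> lclass A B s"

lemma cls_eq: "(s, t) \<in> lcong A B \<Longrightarrow> cls s = cls t"
  unfolding lclass_def by (rule equiv_class_eq[OF lcong_equiv[OF A B]])

lemma coprod_carrierE: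
  assumes "P \<in> carrier (coprod A B)"
  obtains s where "s \<in> lterms A B" "P = cls s"
  using assms by (auto simp: coprod_def lclass_def elim: quotientE)

lemma cls_carrier: "s \<in> lterms A B \<Longrightarrow> cls s \<in> carrier (coprod A B)"
  by (simp add: coprod_def lclass_def quotientI)

lemma coprod_mult:
  assumes "s \<in> lterms A B" "t \<in> lterms A B"
  shows "cls s \<otimes>\<^bsub>coprod A B\<^esub> cls t = cls (Mul s t)"
proof -
  have "congruent2 (lcong A B) (lcong A B) (\<lambda>s t. cls (Mul s t))"
    by (auto simp: congruent2_def del: equalityI intro!: cls_eq lcong.Mul)
  from UN_equiv_class2[OF lcong_equiv[OF A B] lcong_equiv[OF A B] this assms]
  show ?thesis by (simp add: coprod_def lclass_def)
qed

lemma coprod_join: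
  assumes "s \<in> lterms A B" "t \<in> lterms A B"
  shows "cls s \<curlyvee>\<^bsub>coprod A B\<^esub> cls t = cls (Join s t)"
proof -
  have "congruent2 (lcong A B) (lcong A B) (\<lambda>s t. cls (Join s t))"
    by (auto simp: congruent2_def del: equalityI intro!: cls_eq lcong.Join)
  from UN_equiv_class2[OF lcong_equiv[OF A B] lcong_equiv[OF A B] this assms]
  show ?thesis by (simp add: coprod_def lclass_def)
qed

lemma coprod_one: "\<one>\<^bsub>coprod A B\<^esub> = cls Unit"
  by (simp add: coprod_def)

lemma coprod_lgroup: "lattice_ordered_group (coprod A B)"
proof -
  note [simp] = coprod_mult coprod_join coprod_one cls_carrier lterms.intros
  have "group (coprod A B)"
  proof (rule groupI)
    fix x assume "x \<in> carrier (coprod A B)"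
    then obtain s where s: "s \<in> lterms A B" "x = cls s" by (rule coprod_carrierE)
    show "\<exists>y\<in>carrier (coprod A B). y \<otimes>\<^bsub>coprod A B\<^esub> x = \<one>\<^bsub>coprod A B\<^esub>"
      by (rule bexI[of _ "cls (Inv s)"]) (use s in \<open>auto del: equalityI intro!: cls_eq lcong.inv\<close>)
  qed (auto elim!: coprod_carrierE del: equalityI intro!: cls_eq
        intro: lcong.mul_assoc lcong.unit lcong.join_assoc
        lcong.join_comm lcong.join_idem lcong.mul_join lcong.join_mul)
  then show ?thesis
    by (intro lattice_ordered_group.intro lattice_ordered_group_axioms.intro)
      (auto elim!: coprod_carrierE del: equalityI intro!: cls_eq
        intro: lcong.mul_assoc lcong.unit lcong.join_assoc
        lcong.join_comm lcong.join_idem lcong.mul_join lcong.join_mul)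
qed

lemma inj_left_lhom: "inj_left A B \<in> lhom A (coprod A B)"
  by (rule lhomI)
    (auto simp: inj_left_def cls_carrier coprod_mult coprod_join lterms.intros
       del: equalityI intro!: cls_eq lcong.genL_mul lcong.genL_join)

lemma inj_right_lhom: "inj_right A B \<in> lhom B (coprod A B)"
  by (rule lhomI)
    (auto simp: inj_right_def cls_carrier coprod_mult coprod_join lterms.intros
       del: equalityI intro!: cls_eq lcong.genR_mul lcong.genR_join)

context
  fixes C :: "'c lgrp" and f g
  assumes C: "lattice_ordered_group C" and f: "f \<in> lhom A C" and g: "g \<in> lhom B C"
begin

interpretation C: lattice_ordered_group C by (rule C)

lemma lterm_eval_closed: "s \<in> lterms A B \<Longrightarrow> lterm_eval C f g s \<in> carrier C"
  by (induction rule: lterms.induct) (auto simp: lhomD[OF f] lhomD[OF g] C.join_closed)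

lemma lterm_eval_cong:
  "(s, t) \<in> lcong A B \<Longrightarrow> lterm_eval C f g s = lterm_eval C f g t"
proof (induction rule: lcong.induct)
  case (join_comm s t)
  then show ?case by (simp add: C.join_comm[OF lterm_eval_closed lterm_eval_closed])
qed (simp_all add: lterm_eval_closed lhomD(2-4)[OF f] lhomD(2-4)[OF g] C.m_assoc C.join_assoc
       C.join_idem C.mult_join C.join_mult)

lemma copair_cls:
  assumes "s \<in> lterms A B"
  shows "copair C f g (cls s) = lterm_eval C f g s"
proof -
  have "lterm_eval C f g ` cls s = {lterm_eval C f g s}"
  proof -
    have "s \<in> cls s" using lcong.refl[OF assms] by (simp add: lclass_def)
    moreover have "lterm_eval C f g t = lterm_eval C f g s" if "t \<in> cls s" for t
      using lterm_eval_cong[of s t] that by (simp add: lclass_def)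
    ultimately show ?thesis by blast
  qed
  then show ?thesis by (simp add: copair_def)
qed

lemma copair_lhom: "copair C f g \<in> lhom (coprod A B) C"
  by (rule lhomI)
    (auto elim!: coprod_carrierE
       simp: copair_cls coprod_mult coprod_join lterms.intros lterm_eval_closed)

lemma copair_inj_left: "a \<in> carrier A \<Longrightarrow> copair C f g (inj_left A B a) = f a"
  by (simp add: inj_left_def copair_cls lterms.intros)

lemma copair_inj_right: "b \<in> carrier B \<Longrightarrow> copair C f g (inj_right A B b) = g b"
  by (simp add: inj_right_def copair_cls lterms.intros)

lemma copair_unique:
  assumes h: "h \<in> lhom (coprod A B) C"
    and hl: "\<And>a. a \<in> carrier A \<Longrightarrow> h (inj_left A B a) = f a"
    and hr: "\<And>b. b \<in> carrier B \<Longrightarrow> h (inj_right A B b) = g b"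
    and P: "P \<in> carrier (coprod A B)"
  shows "h P = copair C f g P"
proof -
  interpret P: lattice_ordered_group "coprod A B" by (rule coprod_lgroup)
  note hg = lhom_group[OF coprod_lgroup C h]
  have "h (cls s) = lterm_eval C f g s" if "s \<in> lterms A B" for s
    using that
  proof (induction rule: lterms.induct)
    case (1 a) then show ?case using hl by (simp add: inj_left_def)
  next
    case (2 b) then show ?case using hr by (simp add: inj_right_def)
  next
    case 3 then show ?case using hg(2) by (simp add: coprod_one)
  next
    case (4 s)
    have "inv\<^bsub>coprod A B\<^esub> (cls s) = cls (Inv s)"
      by (rule P.inv_equality)
        (use 4 in \<open>auto simp: coprod_mult coprod_one cls_carrier lterms.intros
          del: equalityI intro!: cls_eq lcong.inv\<close>)
    then show ?case using 4 hg(3)[OF cls_carrier[of s]] by simp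
  next
    case (5 s t)
    then show ?case
      using lhomD(3)[OF h cls_carrier cls_carrier, of s t] by (simp add: coprod_mult)
  next
    case (6 s t)
    then show ?case
      using lhomD(4)[OF h cls_carrier cls_carrier, of s t] by (simp add: coprod_join)
  qed
  then show ?thesis using P by (auto elim!: coprod_carrierE simp: copair_cls)
qed

end

lemma Sigma_map_lhom: "Sigma_map A B \<in> lhom (coprod A B) (lprod A B)"
  unfolding Sigma_map_def
  by (rule copair_lhom[OF lprod_lgroup[OF A B]])
    (auto simp: lprod_def A.join_idem B.join_idem intro!: lhomI)

lemma diamond_kernel:
  "lattice_ordered_group (diamond A B)"
  "is_kernel (diamond A B) (coprod A B) (lprod A B) (\<lambda>x. x) (Sigma_map A B)"
  using kernel_lgroup[OF coprod_lgroup lprod_lgroup[OF A B] Sigma_map_lhom]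
  by (simp_all add: diamond_def)

lemma higgins_commutator_lgroup:
  assumes X: "lattice_ordered_group X" and a: "a \<in> lhom A X" and b: "b \<in> lhom B X"
  shows "lattice_ordered_group (higgins_commutator A B X a b)"
proof -
  have "copair X a b \<in> lhom (diamond A B) X"
    using lhomD[OF copair_lhom[OF X a b]]
    by (intro lhomI) (auto simp: diamond_def kernel_def)
  from image_lgroup(1)[OF diamond_kernel(1) X this]
  show ?thesis by (simp add: higgins_commutator_def)
qed

end

end

theory Submission
  imports Defs
begin

text \<open>The Higgins commutator of two normal subobjects of a lattice-ordered group is their
  intersection, and intersections of kernels are kernels. It is contained in each of them because
  the quotient by one subobject turns the copairing into a map factoring through \<open>\<Sigma>\<close>.
  Conversely, the meet \<open>x \<and> y\<close> of positive elements \<open>x\<close> and \<open>y\<close> vanishes when \<open>x\<close> or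
  \<open>y\<close> does, so \<open>y = y \<and> y\<close> lies in the commutator for every positive \<open>y\<close> in the
  intersection; and the positive elements generate.\<close>

lemma lhom_compose: "\<lbrakk>f \<in> lhom A B; g \<in> lhom B C\<rbrakk> \<Longrightarrow> (\<lambda>x. g (f x)) \<in> lhom A C"
  by (auto simp: lhomD intro!: lhomI)

text \<open>This is the zero morphism; idempotence of the join is what makes it preserve
  joins.\<close>

lemma const_one_lhom:
  assumes "lattice_ordered_group C"
  shows "(\<lambda>_. \<one>\<^bsub>C\<^esub>) \<in> lhom A C"
proof -
  interpret C: lattice_ordered_group C by fact
  show ?thesis by (auto simp: C.join_idem intro!: lhomI)
qed

context lattice_ordered_group
begin

text \<open>Left multiplication by \<open>inv y\<close> distributes over the join and turns the
  positivity of \<open>y\<close> into this identity. It later makes a meet with the unit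
  trivial.\<close>

lemma join_inv_one_eq_one:
  assumes y: "y \<in> carrier G" and pos: "y \<curlyvee> \<one> = y"
  shows "inv y \<curlyvee> \<one> = \<one>"
proof -
  have "inv y \<curlyvee> \<one> = \<one> \<curlyvee> inv y" using y by (intro join_comm) simp_all
  also have "\<dots> = inv y \<otimes> (y \<curlyvee> \<one>)" using y by (simp add: mult_join)
  finally show ?thesis using y pos by simp
qed

text \<open>Distributing \<open>x\<close> over \<open>inv x \<curlyvee> \<one>\<close> yields the
  positive part of \<open>x\<close>. Hence a subgroup contains \<open>x\<close> once it contains the
  positive parts of \<open>x\<close> and \<open>inv x\<close>.\<close>

lemma positive_part_decomposition:
  assumes x: "x \<in> carrier G"
  shows "x = (x \<curlyvee> \<one>) \<otimes> inv (inv x \<curlyvee> \<one>)"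
proof -
  have "x \<otimes> (inv x \<curlyvee> \<one>) = x \<curlyvee> \<one>" using x by (simp add: mult_join join_comm)
  then show ?thesis using x by (metis inv_solve_right inv_closed join_closed one_closed)
qed

end

context
  fixes A :: "'a lgrp" and B :: "'b lgrp" and X :: "'x lgrp" and a b
  assumes A: "lattice_ordered_group A" and B: "lattice_ordered_group B"
    and X: "lattice_ordered_group X" and a: "a \<in> lhom A X" and b: "b \<in> lhom B X"
begin

text \<open>Both sides are morphisms out of the coproduct that agree on the two injections, so
  uniqueness of the copairing applies.\<close>

lemma copair_compose:
  assumes Y: "lattice_ordered_group Y" and f: "f \<in> lhom X Y" and P: "P \<in> carrier (coprod A B)"
  shows "f (copair X a b P) = copair Y (\<lambda>x. f (a x)) (\<lambda>x. f (b x)) P"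
  by (rule copair_unique[OF A B Y lhom_compose[OF a f] lhom_compose[OF b f]
        lhom_compose[OF copair_lhom[OF A B X a b] f] _ _ P])
    (simp_all add: copair_inj_left[OF A B X a b] copair_inj_right[OF A B X a b])

lemma copair_Sigma_kernel:
  assumes "P \<in> carrier (diamond A B)"
  shows "P \<in> carrier (coprod A B)" "Sigma_map A B P = (\<one>\<^bsub>A\<^esub>, \<one>\<^bsub>B\<^esub>)"
  using assms by (simp_all add: diamond_def kernel_def lprod_def)

lemma Sigma_map_inj:
  "x \<in> carrier A \<Longrightarrow> Sigma_map A B (inj_left A B x) = (x, \<one>\<^bsub>B\<^esub>)"
  "y \<in> carrier B \<Longrightarrow> Sigma_map A B (inj_right A B y) = (\<one>\<^bsub>A\<^esub>, y)"
proof -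
  have l: "(\<lambda>x. (x, \<one>\<^bsub>B\<^esub>)) \<in> lhom A (lprod A B)"
    by (rule lprod_universal(3)) (auto simp: const_one_lhom[OF B] intro: lhomI)
  have r: "(\<lambda>y. (\<one>\<^bsub>A\<^esub>, y)) \<in> lhom B (lprod A B)"
    by (rule lprod_universal(3)) (auto simp: const_one_lhom[OF A] intro: lhomI)
  show "x \<in> carrier A \<Longrightarrow> Sigma_map A B (inj_left A B x) = (x, \<one>\<^bsub>B\<^esub>)"
    unfolding Sigma_map_def by (rule copair_inj_left[OF A B lprod_lgroup[OF A B] l r])
  show "y \<in> carrier B \<Longrightarrow> Sigma_map A B (inj_right A B y) = (\<one>\<^bsub>A\<^esub>, y)"
    unfolding Sigma_map_def by (rule copair_inj_right[OF A B lprod_lgroup[OF A B] l r])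
qed

text \<open>When \<open>f\<close> kills \<open>A\<close>, the morphisms
  \<open>f \<circ> [a, b]\<close> and \<open>f \<circ> b \<circ> snd \<circ> Sigma_map A B\<close>
  agree on both injections, hence everywhere. The latter is trivial on the kernel of
  \<open>Sigma_map A B\<close>.\<close>

lemma copair_diamond_killed_left:
  assumes Y: "lattice_ordered_group Y" and f: "f \<in> lhom X Y"
    and fa: "\<And>x. x \<in> carrier A \<Longrightarrow> f (a x) = \<one>\<^bsub>Y\<^esub>"
    and P: "P \<in> carrier (diamond A B)"
  shows "f (copair X a b P) = \<one>\<^bsub>Y\<^esub>"
proof -
  note fb = lhom_compose[OF b f]
  have "f (copair X a b P) = copair Y (\<lambda>x. f (a x)) (\<lambda>x. f (b x)) P"
    by (rule copair_compose[OF Y f copair_Sigma_kernel(1)[OF P]])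
  also have "\<dots> = f (b (snd (Sigma_map A B P)))"
    by (rule copair_unique[OF A B Y lhom_compose[OF a f] fb
          lhom_compose[OF lhom_compose[OF Sigma_map_lhom[OF A B] lprod_universal(2)] fb] _ _
          copair_Sigma_kernel(1)[OF P], symmetric])
      (simp_all add: Sigma_map_inj lhom_group(2)[OF B Y fb] fa)
  finally show ?thesis by (simp add: copair_Sigma_kernel(2)[OF P] lhom_group(2)[OF B Y fb])
qed

text \<open>Mirror image: here \<open>f \<circ> [a, b]\<close> factors through
  \<open>Sigma_map A B\<close> followed by the first projection.\<close>

lemma copair_diamond_killed_right:
  assumes Y: "lattice_ordered_group Y" and f: "f \<in> lhom X Y"
    and fb: "\<And>y. y \<in> carrier B \<Longrightarrow> f (b y) = \<one>\<^bsub>Y\<^esub>"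
    and P: "P \<in> carrier (diamond A B)"
  shows "f (copair X a b P) = \<one>\<^bsub>Y\<^esub>"
proof -
  note fa = lhom_compose[OF a f]
  have "f (copair X a b P) = copair Y (\<lambda>x. f (a x)) (\<lambda>x. f (b x)) P"
    by (rule copair_compose[OF Y f copair_Sigma_kernel(1)[OF P]])
  also have "\<dots> = f (a (fst (Sigma_map A B P)))"
    by (rule copair_unique[OF A B Y fa lhom_compose[OF b f]
          lhom_compose[OF lhom_compose[OF Sigma_map_lhom[OF A B] lprod_universal(1)] fa] _ _
          copair_Sigma_kernel(1)[OF P], symmetric])
      (simp_all add: Sigma_map_inj lhom_group(2)[OF A Y fa] fb)
  finally show ?thesis by (simp add: copair_Sigma_kernel(2)[OF P] lhom_group(2)[OF A Y fa])
qed

lemma subgroup_higgins_commutator: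
  "subgroup (carrier (higgins_commutator A B X a b)) X"
proof -
  have "copair X a b \<in> lhom (diamond A B) X"
    using lhom_compose[OF _ copair_lhom[OF A B X a b], of "\<lambda>P. P"] diamond_kernel(2)[OF A B]
    by (simp add: is_kernel_def)
  from group_hom.img_is_subgroup[OF lhom_group(1)[OF diamond_kernel(1)[OF A B] X this]]
  show ?thesis by (simp add: higgins_commutator_def)
qed

text \<open>The witness in \<open>diamond A B\<close> is the meet of the two injected elements:
  \<open>Sigma_map\<close> sends it to the meet of \<open>(x, \<one>)\<close> and
  \<open>(\<one>, y)\<close>, the copairing to the meet of \<open>a x\<close> with itself.\<close>

lemma positive_mem_higgins_commutator:
  assumes x: "x \<in> carrier A" "x \<curlyvee>\<^bsub>A\<^esub> \<one>\<^bsub>A\<^esub> = x"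
    and y: "y \<in> carrier B" "y \<curlyvee>\<^bsub>B\<^esub> \<one>\<^bsub>B\<^esub> = y"
    and eq: "a x = b y"
  shows "a x \<in> carrier (higgins_commutator A B X a b)"
proof -
  interpret A: lattice_ordered_group A by (rule A)
  interpret B: lattice_ordered_group B by (rule B)
  interpret X: lattice_ordered_group X by (rule X)
  interpret P: lattice_ordered_group "lprod A B" by (rule lprod_lgroup[OF A B])
  interpret C: lattice_ordered_group "coprod A B" by (rule coprod_lgroup[OF A B])
  define l r where "l = inj_left A B x" and "r = inj_right A B y"
  have l: "l \<in> carrier (coprod A B)" and r: "r \<in> carrier (coprod A B)"
    unfolding l_def r_def
    using lhomD(2)[OF inj_left_lhom[OF A B]] lhomD(2)[OF inj_right_lhom[OF A B]] x y by blast+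
  \<comment> \<open>\<open>m\<close> is the meet of \<open>l\<close> and \<open>r\<close>\<close>
  define m where "m = inv\<^bsub>coprod A B\<^esub> (inv\<^bsub>coprod A B\<^esub> l \<curlyvee>\<^bsub>coprod A B\<^esub> inv\<^bsub>coprod A B\<^esub> r)"
  have m: "m \<in> carrier (coprod A B)" using l r by (simp add: m_def C.join_closed)
  \<comment> \<open>Morphisms preserve meets, since these are built from inverses and a join. The
    target is arbitrary because both \<open>Sigma_map\<close> and the copairing are needed.\<close>
  have hom_m: "g m = inv\<^bsub>Y\<^esub> (inv\<^bsub>Y\<^esub> g l \<curlyvee>\<^bsub>Y\<^esub> inv\<^bsub>Y\<^esub> g r)"
    if "lattice_ordered_group Y" "g \<in> lhom (coprod A B) Y" for g and Y :: "'y lgrp"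
    using l r lhom_group(3)[OF coprod_lgroup[OF A B] that] lhomD(4)[OF that(2)]
    by (simp add: m_def C.join_closed)
  have "inv\<^bsub>lprod A B\<^esub> (x, \<one>\<^bsub>B\<^esub>) = (inv\<^bsub>A\<^esub> x, \<one>\<^bsub>B\<^esub>)" "inv\<^bsub>lprod A B\<^esub> (\<one>\<^bsub>A\<^esub>, y) = (\<one>\<^bsub>A\<^esub>, inv\<^bsub>B\<^esub> y)"
    by (rule P.inv_equality; use x y in \<open>simp add: lprod_def\<close>)+
  \<comment> \<open>Positivity enters here, separately in each coordinate.\<close>
  moreover have "(inv\<^bsub>A\<^esub> x, \<one>\<^bsub>B\<^esub>) \<curlyvee>\<^bsub>lprod A B\<^esub> (\<one>\<^bsub>A\<^esub>, inv\<^bsub>B\<^esub> y) = \<one>\<^bsub>lprod A B\<^esub>"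
    using A.join_inv_one_eq_one[OF x] B.join_inv_one_eq_one[OF y] B.join_comm y
    by (simp add: lprod_def)
  ultimately have "Sigma_map A B m = \<one>\<^bsub>lprod A B\<^esub>"
    using hom_m[OF lprod_lgroup[OF A B] Sigma_map_lhom[OF A B]] x y
    by (simp add: l_def r_def Sigma_map_inj)
  then have "m \<in> carrier (diamond A B)" using m by (simp add: diamond_def kernel_def)
  moreover have "copair X a b m = a x"
    using hom_m[OF X copair_lhom[OF A B X a b]] x y eq lhomD(2)[OF b]
    by (simp add: l_def r_def copair_inj_left[OF A B X a b] copair_inj_right[OF A B X a b]
        X.join_idem)
  ultimately show ?thesis unfolding higgins_commutator_def by force
qed

lemma higgins_commutator_eq_inter:
  assumes Y: "lattice_ordered_group Y" and kf: "is_kernel A X Y a f"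
    and Z: "lattice_ordered_group Z" and kg: "is_kernel B X Z b g"
  shows "carrier (higgins_commutator A B X a b) = kernel X Y f \<inter> kernel X Z g"
proof
  have f: "f \<in> lhom X Y" "a ` carrier A = kernel X Y f"
    and g: "g \<in> lhom X Z" "b ` carrier B = kernel X Z g"
    using kf kg by (auto simp: is_kernel_def)
  show "carrier (higgins_commutator A B X a b) \<subseteq> kernel X Y f \<inter> kernel X Z g"
  proof
    fix w assume "w \<in> carrier (higgins_commutator A B X a b)"
    then obtain P where P: "P \<in> carrier (diamond A B)" "w = copair X a b P"
      by (auto simp: higgins_commutator_def)
    have "w \<in> carrier X"
      using P copair_Sigma_kernel(1) lhomD(2)[OF copair_lhom[OF A B X a b]] by simp
    moreover have "f w = \<one>\<^bsub>Y\<^esub>"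
      unfolding P(2) using f(2)
      by (intro copair_diamond_killed_left[OF Y f(1) _ P(1)]) (auto simp: kernel_def)
    moreover have "g w = \<one>\<^bsub>Z\<^esub>"
      unfolding P(2) using g(2)
      by (intro copair_diamond_killed_right[OF Z g(1) _ P(1)]) (auto simp: kernel_def)
    ultimately show "w \<in> kernel X Y f \<inter> kernel X Z g" by (simp add: kernel_def)
  qed
  interpret A: lattice_ordered_group A by (rule A)
  interpret B: lattice_ordered_group B by (rule B)
  interpret X: lattice_ordered_group X by (rule X)
  interpret Y: group Y by (rule lgrp_groupD[OF Y])
  interpret Z: group Z by (rule lgrp_groupD[OF Z])
  \<comment> \<open>Preimages of \<open>w\<close> in \<open>A\<close> and \<open>B\<close> need not
    be positive; joining each with the unit makes them positive, and both are then sent to the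
    positive part of \<open>w\<close>.\<close>
  have pos: "w \<curlyvee>\<^bsub>X\<^esub> \<one>\<^bsub>X\<^esub> \<in> carrier (higgins_commutator A B X a b)"
    if w: "w \<in> kernel X Y f" "w \<in> kernel X Z g" for w
  proof -
    from w(1) obtain x where x: "x \<in> carrier A" "a x = w"
      unfolding f(2)[symmetric] by (elim imageE) simp
    from w(2) obtain y where y: "y \<in> carrier B" "b y = w"
      unfolding g(2)[symmetric] by (elim imageE) simp
    have pa: "a (x \<curlyvee>\<^bsub>A\<^esub> \<one>\<^bsub>A\<^esub>) = w \<curlyvee>\<^bsub>X\<^esub> \<one>\<^bsub>X\<^esub>" and pb: "b (y \<curlyvee>\<^bsub>B\<^esub> \<one>\<^bsub>B\<^esub>) = w \<curlyvee>\<^bsub>X\<^esub> \<one>\<^bsub>X\<^esub>"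
      using x y lhom_group(2)[OF A X a] lhom_group(2)[OF B X b]
      by (simp_all add: lhomD(4)[OF a] lhomD(4)[OF b])
    have "a (x \<curlyvee>\<^bsub>A\<^esub> \<one>\<^bsub>A\<^esub>) \<in> carrier (higgins_commutator A B X a b)"
      by (rule positive_mem_higgins_commutator[of _ "y \<curlyvee>\<^bsub>B\<^esub> \<one>\<^bsub>B\<^esub>"])
        (use x(1) y(1) pa pb in \<open>simp_all add: A.join_closed A.join_assoc A.join_idem
          B.join_closed B.join_assoc B.join_idem\<close>)
    then show ?thesis unfolding pa .
  qed
  show "kernel X Y f \<inter> kernel X Z g \<subseteq> carrier (higgins_commutator A B X a b)"
  proof
    fix w assume w: "w \<in> kernel X Y f \<inter> kernel X Z g"
    \<comment> \<open>The kernels are closed under inverses, so \<open>pos\<close> covers both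
      factors in the decomposition of \<open>w\<close>.\<close>
    have "inv\<^bsub>X\<^esub> w \<in> kernel X Y f" "inv\<^bsub>X\<^esub> w \<in> kernel X Z g"
      using w lhom_group(3)[OF X Y f(1)] lhom_group(3)[OF X Z g(1)] by (simp_all add: kernel_def)
    then have "(w \<curlyvee>\<^bsub>X\<^esub> \<one>\<^bsub>X\<^esub>) \<otimes>\<^bsub>X\<^esub> inv\<^bsub>X\<^esub> (inv\<^bsub>X\<^esub> w \<curlyvee>\<^bsub>X\<^esub> \<one>\<^bsub>X\<^esub>)
        \<in> carrier (higgins_commutator A B X a b)"
      using w by (intro subgroup.m_closed[OF subgroup_higgins_commutator]
          subgroup.m_inv_closed[OF subgroup_higgins_commutator] pos) simp_all
    moreover have "w \<in> carrier X" using w by (simp add: kernel_def)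
    ultimately show "w \<in> carrier (higgins_commutator A B X a b)"
      using X.positive_part_decomposition[of w] by simp
  qed
qed

end

theorem proposition8p7:
  fixes X :: "'x lgrp" and H :: "'h lgrp" and K :: "'k lgrp"
    and h :: "'h \<Rightarrow> 'x" and k :: "'k \<Rightarrow> 'x"
  assumes "lattice_ordered_group X"
    and "lattice_ordered_group H"
    and "lattice_ordered_group K"
    and "normal_subobject H X h"
    and "normal_subobject K X k"
  shows "normal_subobject (higgins_commutator H K X h k) X (\<lambda>x. x)"
proof -
  obtain Y :: "'x set lgrp" and f where Y: "lattice_ordered_group Y" "is_kernel H X Y h f"
    using assms(4) unfolding normal_subobject_def by blast
  obtain Z :: "'x set lgrp" and g where Z: "lattice_ordered_group Z" "is_kernel K X Z k g"
    using assms(5) unfolding normal_subobject_def by blast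
  have hf: "h \<in> lhom H X" "f \<in> lhom X Y" and kg: "k \<in> lhom K X" "g \<in> lhom X Z"
    using Y(2) Z(2) by (simp_all add: is_kernel_def)
  \<comment> \<open>Pairing the two morphisms realizes the intersection of their kernels as a single
    kernel.\<close>
  let ?fg = "\<lambda>x. (f x, g x)"
  have fg: "?fg \<in> lhom X (lprod Y Z)" using lprod_universal(3) hf(2) kg(2) by blast
  have "carrier (higgins_commutator H K X h k) = kernel X Y f \<inter> kernel X Z g"
    by (rule higgins_commutator_eq_inter[OF assms(2,3,1) hf(1) kg(1) Y Z])
  also have "\<dots> = kernel X (lprod Y Z) ?fg"
    by (auto simp: kernel_def lprod_def)
  finally have "higgins_commutator H K X h k = sub_lgrp X (kernel X (lprod Y Z) ?fg)"
    by (simp add: higgins_commutator_def)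
  \<comment> \<open>The codomain \<open>lprod Y Z\<close> lives over pairs of sets;
    \<open>normal_subobjectI\<close> replaces it by a lattice-ordered group over
    \<open>'x set\<close>.\<close>
  then show ?thesis
    using normal_subobjectI[OF assms(1) lprod_lgroup[OF Y(1) Z(1)]
        kernel_lgroup(2)[OF assms(1) lprod_lgroup[OF Y(1) Z(1)] fg]] by simp
qed

end
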